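(* Consider the self-reinforced preferential attachment tree with degrees $d_t(i)$ and weights $\theta_t(i)=\sum_{s=1}^t d_s(i)$, and let $\alpha_t(i)=\frac{t\,d_t(i)}{\theta_t(i)}$ for $t\ge i$, $t \geq 1$. Then, for every integer $i\geq 1$, $$\lim_{t\to\infty}\alpha_t(i)=\phi \quad \mathbb{P}\text{-almost surely},\qquad \phi=\tfrac12(1+\sqrt5).$$
   Context: The self-reinforced preferential attachment tree (SRPAT) is the following random growing tree. At time $0$ there is a single isolated vertex $v_0$. At time $1$ a vertex $v_1$ arrives and attaches itself to $v_0$ by a single edge. For $t\ge 1$, at time $t+1$ a vertex $v_{t+1}$ arrives and attaches itself by a single edge to exactly one of the vertices $v_0,\dots,v_t$; writing $\{t+1\to i\}$ for the event that $v_{t+1}$ attaches itself to $v_i$, the conditional probability given the history of the tree up to time $t$ is $$\mathbb{P}(t+1\to i\mid \mathcal{F}_t)=\frac{\theta_t(i)}{\sum_{j=0}^t\theta_t(j)}=\frac{\theta_t(i)}{t(t+1)},\qquad 0\le i\le t,$$ where $d_s(i)$ is the degree of $v_i$ at time $s$ (with $d_s(i)=0$ for $1\le s<i$ and $d_i(i)=1$ for $i\ge 1$; $d_1(0)=1$), $\theta_t(i)=\sum_{s=1}^t d_s(i)$, and $\mathcal{F}_t=\sigma(d_s(j):1\le s\le t,\ 0\le j\le t)$. Thus $d_{t+1}(i)=d_t(i)+\mathbb{1}_{\{t+1\to i\}}$ for $0\le i\le t$. $\mathbb{P}$ denotes the law of this process. *)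

theory Defs
  imports "HOL-Probability.Probability"
begin

text \<open>
  A realisation of the tree is a function p, where p s is the index of the vertex to which
  vertex s attaches itself (s \<open>\<ge>\<close> 1; the value p 0 plays no role). Vertices are identified with
  their indices, and the edges of the tree at time t are the two-element sets {s, p s} with
  1 \<open>\<le>\<close> s \<open>\<le>\<close> t.
\<close>

definition tree_edges :: "(nat \<Rightarrow> nat) \<Rightarrow> nat \<Rightarrow> nat set set" where
  "tree_edges p t = (\<lambda>s. {s, p s}) ` {1..t}"

definition tree_degree :: "(nat \<Rightarrow> nat) \<Rightarrow> nat \<Rightarrow> nat \<Rightarrow> nat" where
  "tree_degree p t i = card {e \<in> tree_edges p t. i \<in> e}"

definition tree_weight :: "(nat \<Rightarrow> nat) \<Rightarrow> nat \<Rightarrow> nat \<Rightarrow> nat" where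
  "tree_weight p t i = (\<Sum>s=1..t. tree_degree p s i)"

definition tree_alpha :: "(nat \<Rightarrow> nat) \<Rightarrow> nat \<Rightarrow> nat \<Rightarrow> real" where
  "tree_alpha p t i = real t * real (tree_degree p t i) / real (tree_weight p t i)"

definition tree_history :: "'a measure \<Rightarrow> ('a \<Rightarrow> nat \<Rightarrow> nat) \<Rightarrow> nat \<Rightarrow> 'a measure" where
  "tree_history M X t =
     sigma (space M)
       {(\<lambda>\<omega>. tree_degree (X \<omega>) s j) -` A \<inter> space M | s j A. s \<in> {1..t} \<and> j \<in> {0..t}}"

locale srpat = prob_space M
  for M :: "'a measure" and X :: "'a \<Rightarrow> nat \<Rightarrow> nat" +
  assumes attach_measurable: "(\<lambda>\<omega>. X \<omega> t) \<in> measurable M (count_space UNIV)"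
    and attach_existing: "\<omega> \<in> space M \<Longrightarrow> X \<omega> (Suc t) \<le> t"
    and attach_cond_prob:
      "1 \<le> t \<Longrightarrow> i \<le> t \<Longrightarrow>
       (AE \<omega> in M.
          real_cond_exp M (tree_history M X t) (indicator {\<omega> \<in> space M. X \<omega> (Suc t) = i}) \<omega> =
          real (tree_weight (X \<omega>) t i) / (\<Sum>j=0..t. real (tree_weight (X \<omega>) t j)))"

lemma finite_tree_edges: "finite (tree_edges p t)"
  by (simp add: tree_edges_def)

lemma tree_edges_Suc: "tree_edges p (Suc t) = insert {Suc t, p (Suc t)} (tree_edges p t)"
  by (simp add: tree_edges_def atLeastAtMostSuc_conv)

context
  fixes p :: "nat \<Rightarrow> nat"
  assumes parent_le: "\<And>t. p (Suc t) \<le> t"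
begin

lemma tree_edges_subset: "e \<in> tree_edges p t \<Longrightarrow> e \<subseteq> {0..t}"
proof (induction t)
  case 0
  then show ?case by (simp add: tree_edges_def)
next
  case (Suc t)
  then show ?case
    using parent_le[of t] by (fastforce simp: tree_edges_Suc)
qed

lemma tree_degree_before: "t < i \<Longrightarrow> tree_degree p t i = 0"
proof -
  assume "t < i"
  then have "{e \<in> tree_edges p t. i \<in> e} = {}"
    using tree_edges_subset by fastforce
  then show ?thesis by (simp only: tree_degree_def card.empty)
qed

lemma tree_degree_Suc_eq:
  "tree_degree p (Suc t) i =
     tree_degree p t i + (if i = Suc t \<or> i = p (Suc t) then 1 else 0)"
proof -
  have new: "{Suc t, p (Suc t)} \<notin> tree_edges p t"
    using tree_edges_subset[of "{Suc t, p (Suc t)}" t] by auto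
  show ?thesis
  proof (cases "i = Suc t \<or> i = p (Suc t)")
    case True
    then have "{e \<in> tree_edges p (Suc t). i \<in> e} =
        insert {Suc t, p (Suc t)} {e \<in> tree_edges p t. i \<in> e}"
      by (auto simp: tree_edges_Suc)
    then show ?thesis
      using True new finite_tree_edges[of p t] by (simp add: tree_degree_def)
  next
    case False
    then have "{e \<in> tree_edges p (Suc t). i \<in> e} = {e \<in> tree_edges p t. i \<in> e}"
      by (auto simp: tree_edges_Suc)
    then show ?thesis using False by (simp add: tree_degree_def)
  qed
qed

lemma tree_degree_Suc:
  "i \<le> t \<Longrightarrow> tree_degree p (Suc t) i = tree_degree p t i + of_bool (p (Suc t) = i)"
  by (auto simp: tree_degree_Suc_eq)

lemma tree_degree_self: "1 \<le> i \<Longrightarrow> tree_degree p i i = 1"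
  using parent_le by (cases i) (auto simp: tree_degree_Suc_eq tree_degree_before)

lemma tree_degree_root: "tree_degree p 1 0 = 1"
  using parent_le[of 0] tree_degree_Suc_eq[of 0 0] by (simp add: tree_degree_def tree_edges_def)

lemma sum_tree_degree: "s \<le> n \<Longrightarrow> (\<Sum>j=0..n. tree_degree p s j) = 2 * s"
proof (induction s)
  case 0
  then show ?case by (simp add: tree_degree_def tree_edges_def)
next
  case (Suc s)
  have *: "{0..n} \<inter> {j. j = Suc s \<or> j = p (Suc s)} = {Suc s, p (Suc s)}"
    using Suc.prems parent_le[of s] by auto
  have "card {Suc s, p (Suc s)} = 2"
    using parent_le[of s] by auto
  then have "(\<Sum>j=0..n. if j = Suc s \<or> j = p (Suc s) then 1 else 0 :: nat) = 2"
    by (simp only: sum.If_cases finite_atLeastAtMost *) simp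
  then show ?case
    using Suc by (simp add: tree_degree_Suc_eq sum.distrib)
qed

lemma sum_tree_weight: "(\<Sum>j=0..t. tree_weight p t j) = t * (t + 1)"
proof -
  have "(\<Sum>j=0..t. tree_weight p t j) = (\<Sum>s=1..t. \<Sum>j=0..t. tree_degree p s j)"
    unfolding tree_weight_def by (rule sum.swap)
  also have "\<dots> = (\<Sum>s=1..t. 2 * s)"
    by (intro sum.cong) (simp_all add: sum_tree_degree)
  also have "\<dots> = t * (t + 1)"
    by (induction t) auto
  finally show ?thesis .
qed

end

lemma (in srpat) tree_degree_measurable:
  "(\<lambda>\<omega>. tree_degree (X \<omega>) t i) \<in> measurable M (count_space UNIV)"
proof (induction t)
  case 0
  show ?case by (simp add: tree_degree_def tree_edges_def)
next
  case (Suc t)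
  note [measurable] = Suc attach_measurable
  have "(\<lambda>\<omega>. tree_degree (X \<omega>) t i + (if i = Suc t \<or> i = X \<omega> (Suc t) then 1 else 0))
      \<in> measurable M (count_space UNIV)"
    by measurable
  moreover have "tree_degree (X \<omega>) (Suc t) i =
      tree_degree (X \<omega>) t i + (if i = Suc t \<or> i = X \<omega> (Suc t) then 1 else 0)"
    if "\<omega> \<in> space M" for \<omega>
    using that by (intro tree_degree_Suc_eq attach_existing)
  ultimately show ?case by (simp cong: measurable_cong)
qed

text \<open>In particular \<open>real_cond_exp M (tree_history M X t)\<close> is a genuine conditional expectation.\<close>

lemma (in srpat) subalgebra_tree_history: "subalgebra M (tree_history M X t)"
proof -
  have "{(\<lambda>\<omega>. tree_degree (X \<omega>) s j) -` A \<inter> space M | s j A. s \<in> {1..t} \<and> j \<in> {0..t}} \<subseteq> sets M"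
    using measurable_sets[OF tree_degree_measurable] by auto
  moreover have "{(\<lambda>\<omega>. tree_degree (X \<omega>) s j) -` A \<inter> space M | s j A. s \<in> {1..t} \<and> j \<in> {0..t}}
      \<subseteq> Pow (space M)"
    by auto
  ultimately show ?thesis
    unfolding subalgebra_def tree_history_def
    by (simp add: sets.sigma_sets_subset)
qed

end

theory Submission
  imports Defs
begin

text \<open>
  Fix a vertex with degree \<open>d\<close> and weight \<open>\<theta>\<close>, and let \<open>x\<^sub>t = \<theta>\<^sub>t / (t d\<^sub>t)\<close>, the inverse of \<open>\<alpha>\<^sub>t\<close>. Since degrees
  are nondecreasing, \<open>0 < x\<^sub>t \<le> 1\<close>. The recursion reads
  \<open>x\<^sub>t\<^sub>+\<^sub>1 - x\<^sub>t = (1 - x\<^sub>t - x\<^sub>t\<^sup>2) / (t + 1) + \<eta>\<^sub>t\<close>, where \<open>\<eta>\<^sub>t\<close> is a martingale difference of conditional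
  variance at most \<open>p\<^sub>t / (d\<^sub>t (d\<^sub>t + 1))\<close> plus a correction at most
  \<open>1 / (t + 1)\<^sup>2 + p\<^sub>t / (d\<^sub>t (d\<^sub>t + 1))\<close>, with \<open>p\<^sub>t\<close> the attachment probability. As
  \<open>p\<^sub>t / (d\<^sub>t (d\<^sub>t + 1))\<close> is the conditional expectation of \<open>1 / d\<^sub>t - 1 / d\<^sub>t\<^sub>+\<^sub>1\<close>, its expectations have a
  telescoping, hence bounded, sum. So \<open>\<Sum>\<eta>\<^sub>t\<close> converges almost surely without any prior control on
  the growth of \<open>d\<close>, and the recursion drives \<open>x\<close> to the positive root \<open>(sqrt 5 - 1) / 2\<close> of
  \<open>1 - x - x\<^sup>2\<close>.
\<close>

subsection \<open>Square-integrable martingales\<close>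

lemma integrable_mult_of_squares:
  fixes f g :: "'a \<Rightarrow> real"
  assumes [measurable]: "f \<in> borel_measurable M" "g \<in> borel_measurable M"
    and "integrable M (\<lambda>x. (f x)\<^sup>2)" "integrable M (\<lambda>x. (g x)\<^sup>2)"
  shows "integrable M (\<lambda>x. f x * g x)"
proof (rule Bochner_Integration.integrable_bound)
  show "integrable M (\<lambda>x. (f x)\<^sup>2 + (g x)\<^sup>2)"
    using assms by simp
  have "\<bar>a * b\<bar> \<le> a\<^sup>2 + b\<^sup>2" for a b :: real
  proof -
    have "2 * \<bar>a\<bar> * \<bar>b\<bar> \<le> a\<^sup>2 + b\<^sup>2"
      using sum_squares_bound[of "\<bar>a\<bar>" "\<bar>b\<bar>"] by simp
    moreover have "0 \<le> \<bar>a\<bar> * \<bar>b\<bar>" by simp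
    ultimately show ?thesis unfolding abs_mult by linarith
  qed
  then show "AE x in M. norm (f x * g x) \<le> norm ((f x)\<^sup>2 + (g x)\<^sup>2)"
    by (simp add: abs_of_nonneg)
qed simp

text \<open>By Tonelli the sum of the series has a finite integral, so it is finite almost
  everywhere.\<close>

lemma AE_summable_of_summable_integral:
  fixes f :: "nat \<Rightarrow> 'a \<Rightarrow> real"
  assumes int: "\<And>n. integrable M (f n)" and nonneg: "\<And>n \<omega>. \<omega> \<in> space M \<Longrightarrow> 0 \<le> f n \<omega>"
    and "summable (\<lambda>n. \<integral>\<omega>. f n \<omega> \<partial>M)"
  shows "AE \<omega> in M. summable (\<lambda>n. f n \<omega>)"
proof -
  have [measurable]: "f n \<in> borel_measurable M" for n
    using int by auto
  have "(\<integral>\<^sup>+\<omega>. (\<Sum>n. ennreal (f n \<omega>)) \<partial>M) = (\<Sum>n. \<integral>\<^sup>+\<omega>. ennreal (f n \<omega>) \<partial>M)"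
    by (rule nn_integral_suminf) simp
  also have "\<dots> = (\<Sum>n. ennreal (\<integral>\<omega>. f n \<omega> \<partial>M))"
    using int nonneg by (intro suminf_cong nn_integral_eq_integral) auto
  also have "\<dots> = ennreal (\<Sum>n. \<integral>\<omega>. f n \<omega> \<partial>M)"
    using assms(3) nonneg by (intro suminf_ennreal2 integral_nonneg_AE) auto
  finally have "AE \<omega> in M. (\<Sum>n. ennreal (f n \<omega>)) \<noteq> \<infinity>"
    by (intro nn_integral_PInf_AE) auto
  then show ?thesis
    using AE_space
  proof eventually_elim
    case (elim \<omega>)
    then show ?case
      using nonneg by (intro summable_suminf_not_top) auto
  qed
qed

text \<open>\<open>D n\<close> is the increment from time \<open>n\<close> to \<open>Suc n\<close>:
  it is revealed at \<open>F (Suc n)\<close> and centred given \<open>F n\<close>. Hence the partial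
  sum over \<open>j < k\<close> is known at \<open>F k\<close>.\<close>

locale square_integrable_martingale_differences = prob_space M for M :: "'a measure" +
  fixes F :: "nat \<Rightarrow> 'a measure" and D :: "nat \<Rightarrow> 'a \<Rightarrow> real"
  assumes subalg: "subalgebra M (F n)"
    and filtration: "sets (F n) \<subseteq> sets (F (Suc n))"
    and adapted: "D n \<in> borel_measurable (F (Suc n))"
    and square_integrable: "integrable M (\<lambda>\<omega>. (D n \<omega>)\<^sup>2)"
    and centred: "AE \<omega> in M. real_cond_exp M (F n) (D n) \<omega> = 0"
begin

lemma space_F: "space (F n) = space M"
  using subalg by (simp add: subalgebra_def)

lemma borel_measurable_F_mono:
  assumes "m \<le> n" "f \<in> borel_measurable (F m)"
  shows "f \<in> borel_measurable (F n)"
proof -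
  have "sets (F m) \<subseteq> sets (F n)"
    using assms(1) filtration by (rule lift_Suc_mono_le[where f = "\<lambda>n. sets (F n)", rotated])
  then have "subalgebra (F n) (F m)"
    by (simp add: subalgebra_def space_F)
  then show ?thesis
    using assms(2) by (rule measurable_from_subalg)
qed

lemma borel_measurable_D [measurable]: "D n \<in> borel_measurable M"
  using measurable_from_subalg[OF subalg adapted] .

text \<open>A factor known at time \<open>n\<close> can be moved inside the conditional expectation
  given \<open>F n\<close>, which vanishes. This removes the cross terms from second moments of
  partial sums.\<close>

lemma orthogonal:
  assumes Y: "Y \<in> borel_measurable (F n)" "integrable M (\<lambda>\<omega>. (Y \<omega>)\<^sup>2)"
  shows "integrable M (\<lambda>\<omega>. Y \<omega> * D n \<omega>)" "(\<integral>\<omega>. Y \<omega> * D n \<omega> \<partial>M) = 0"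
proof -
  interpret sub: finite_measure_subalgebra M "F n"
    by unfold_locales (rule subalg)
  have YM: "Y \<in> borel_measurable M"
    using measurable_from_subalg[OF subalg Y(1)] .
  show int: "integrable M (\<lambda>\<omega>. Y \<omega> * D n \<omega>)"
    using YM Y(2) square_integrable by (intro integrable_mult_of_squares) auto
  have "(\<integral>\<omega>. Y \<omega> * D n \<omega> \<partial>M) = (\<integral>\<omega>. Y \<omega> * real_cond_exp M (F n) (D n) \<omega> \<partial>M)"
    using int Y(1) by (intro sub.real_cond_exp_intg(2)[symmetric]) auto
  also have "\<dots> = (\<integral>\<omega>. 0 \<partial>M)"
    using centred[of n] YM by (intro integral_cong_AE) auto
  finally show "(\<integral>\<omega>. Y \<omega> * D n \<omega> \<partial>M) = 0" by simp
qed

text \<open>Stopping the partial sums at the first exit keeps their increments orthogonal and does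
  not enlarge the second moments. On the event in question the stopped sum is still outside the
  interval at time \<open>N\<close>, so Chebyshev's inequality at that single time suffices.\<close>

lemma kolmogorov_maximal:
  assumes "0 < \<epsilon>"
  shows "prob {\<omega> \<in> space M. \<exists>k\<le>N. \<epsilon> \<le> \<bar>\<Sum>j<k. D j \<omega>\<bar>} \<le> (\<Sum>j<N. expectation (\<lambda>\<omega>. (D j \<omega>)\<^sup>2)) / \<epsilon>\<^sup>2"
proof -
  \<comment> \<open>\<open>Q k\<close> inspects only the sums up to index \<open>k\<close>, so
    \<open>I k\<close> is known at \<open>F k\<close>, before the increment \<open>D k\<close> it
    multiplies is revealed.\<close>
  define Q where "Q k \<omega> \<longleftrightarrow> (\<forall>l\<le>k. \<bar>\<Sum>j<l. D j \<omega>\<bar> < \<epsilon>)" for k \<omega>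
  define I where "I k \<omega> = (if Q k \<omega> then 1 else 0 :: real)" for k \<omega>
  \<comment> \<open>\<open>T\<close> is the martingale stopped when it first leaves \<open>(-\<epsilon>, \<epsilon>)\<close>.\<close>
  define T where "T k \<omega> = (\<Sum>j<k. I j \<omega> * D j \<omega>)" for k \<omega>
  have D_F: "D j \<in> borel_measurable (F k)" if "j < k" for j k
    using that adapted by (intro borel_measurable_F_mono[of "Suc j" k]) auto
  have S_F: "(\<lambda>\<omega>. \<Sum>j<l. D j \<omega>) \<in> borel_measurable (F k)" if "l \<le> k" for l k
    using that D_F by (intro borel_measurable_sum) auto
  have I_F: "I k \<in> borel_measurable (F k)" for k
  proof -
    have "Measurable.pred (F k) (\<lambda>\<omega>. \<bar>\<Sum>j<l. D j \<omega>\<bar> < \<epsilon>)" if "l \<in> {..k}" for l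
    proof -
      have [measurable]: "(\<lambda>\<omega>. \<Sum>j<l. D j \<omega>) \<in> borel_measurable (F k)"
        using that by (intro S_F) auto
      show ?thesis by measurable
    qed
    then have [measurable]: "Measurable.pred (F k) (\<lambda>\<omega>. \<forall>l\<in>{..k}. \<bar>\<Sum>j<l. D j \<omega>\<bar> < \<epsilon>)"
      by (intro pred_intros_finite) auto
    have "I k = (\<lambda>\<omega>. if \<forall>l\<in>{..k}. \<bar>\<Sum>j<l. D j \<omega>\<bar> < \<epsilon> then 1 else 0)"
      by (auto simp: I_def Q_def)
    then show ?thesis by simp
  qed
  have T_F: "T k \<in> borel_measurable (F k)" for k
    unfolding T_def using I_F D_F
    by (intro borel_measurable_sum borel_measurable_times) (auto intro: borel_measurable_F_mono[OF _ I_F])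
  have [measurable]: "T k \<in> borel_measurable M" "I k \<in> borel_measurable M" for k
    using measurable_from_subalg[OF subalg] T_F I_F by blast+
  have I_sq: "(I k \<omega>)\<^sup>2 = I k \<omega>" "0 \<le> I k \<omega>" "I k \<omega> \<le> 1" for k \<omega>
    by (auto simp: I_def)
  have int_ID: "integrable M (\<lambda>\<omega>. I k \<omega> * (D k \<omega>)\<^sup>2)" for k
    using square_integrable
  proof (rule Bochner_Integration.integrable_bound)
    show "AE \<omega> in M. norm (I k \<omega> * (D k \<omega>)\<^sup>2) \<le> norm ((D k \<omega>)\<^sup>2)"
      by (simp add: I_def)
  qed simp
  have T: "integrable M (\<lambda>\<omega>. (T k \<omega>)\<^sup>2) \<and>
      expectation (\<lambda>\<omega>. (T k \<omega>)\<^sup>2) \<le> (\<Sum>j<k. expectation (\<lambda>\<omega>. (D j \<omega>)\<^sup>2))" for k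
  proof (induction k)
    case 0
    then show ?case by (simp add: T_def)
  next
    case (Suc k)
    have TI: "integrable M (\<lambda>\<omega>. (T k \<omega> * I k \<omega>)\<^sup>2)"
      using conjunct1[OF Suc]
    proof (rule Bochner_Integration.integrable_bound)
      show "AE \<omega> in M. norm ((T k \<omega> * I k \<omega>)\<^sup>2) \<le> norm ((T k \<omega>)\<^sup>2)"
        by (simp add: I_def)
    qed simp
    have TI_F: "(\<lambda>\<omega>. T k \<omega> * I k \<omega>) \<in> borel_measurable (F k)"
      using T_F I_F by (intro borel_measurable_times)
    \<comment> \<open>The cross term in the square of \<open>T (Suc k)\<close> is \<open>D k\<close>
      times a quantity known at \<open>F k\<close>, so its expectation is 0.\<close>
    note orth = orthogonal[OF TI_F TI]
    have eq: "(T (Suc k) \<omega>)\<^sup>2 = (T k \<omega>)\<^sup>2 + 2 * (T k \<omega> * I k \<omega> * D k \<omega>) + I k \<omega> * (D k \<omega>)\<^sup>2" for \<omega>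
    proof -
      have "(T (Suc k) \<omega>)\<^sup>2 = (T k \<omega> + I k \<omega> * D k \<omega>)\<^sup>2" by (simp add: T_def)
      also have "\<dots> = (T k \<omega>)\<^sup>2 + 2 * (T k \<omega> * I k \<omega> * D k \<omega>) + (I k \<omega>)\<^sup>2 * (D k \<omega>)\<^sup>2"
        by (simp add: power2_eq_square algebra_simps)
      finally show ?thesis by (simp add: I_sq)
    qed
    have "expectation (\<lambda>\<omega>. (T (Suc k) \<omega>)\<^sup>2) =
        expectation (\<lambda>\<omega>. (T k \<omega>)\<^sup>2) + expectation (\<lambda>\<omega>. I k \<omega> * (D k \<omega>)\<^sup>2)"
      unfolding eq using Suc orth int_ID by simp
    moreover have "expectation (\<lambda>\<omega>. I k \<omega> * (D k \<omega>)\<^sup>2) \<le> expectation (\<lambda>\<omega>. (D k \<omega>)\<^sup>2)"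
      using int_ID square_integrable by (intro integral_mono) (auto simp: I_def)
    moreover have "integrable M (\<lambda>\<omega>. (T (Suc k) \<omega>)\<^sup>2)"
      unfolding eq using Suc orth int_ID by simp
    ultimately show ?case
      using Suc by simp
  qed
  have stopped: "\<epsilon> \<le> \<bar>T N \<omega>\<bar>" if ex: "\<exists>k\<le>N. \<epsilon> \<le> \<bar>\<Sum>j<k. D j \<omega>\<bar>" for \<omega>
  proof -
    define \<tau> where "\<tau> = (LEAST k. \<epsilon> \<le> \<bar>\<Sum>j<k. D j \<omega>\<bar>)"
    obtain k where k: "k \<le> N" "\<epsilon> \<le> \<bar>\<Sum>j<k. D j \<omega>\<bar>" using ex by blast
    have \<tau>: "\<epsilon> \<le> \<bar>\<Sum>j<\<tau>. D j \<omega>\<bar>" "\<tau> \<le> N"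
      using LeastI[of "\<lambda>k. \<epsilon> \<le> \<bar>\<Sum>j<k. D j \<omega>\<bar>", OF k(2)] Least_le[of "\<lambda>k. \<epsilon> \<le> \<bar>\<Sum>j<k. D j \<omega>\<bar>", OF k(2)] k(1)
      unfolding \<tau>_def by auto
    have "I j \<omega> = (if j < \<tau> then 1 else 0)" for j
    proof (cases "j < \<tau>")
      case True
      then have "Q j \<omega>"
        unfolding Q_def \<tau>_def by (meson le_less_trans not_less_Least not_le)
      with True show ?thesis by (simp add: I_def)
    next
      case False
      then have "\<not> Q j \<omega>"
        using \<tau>(1) unfolding Q_def by (auto simp: not_less)
      with False show ?thesis by (simp add: I_def)
    qed
    then have "T N \<omega> = (\<Sum>j<N. if j < \<tau> then D j \<omega> else 0)"
      unfolding T_def by (intro sum.cong) auto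
    also have "\<dots> = (\<Sum>j<\<tau>. D j \<omega>)"
      using \<tau>(2) by (intro sum.mono_neutral_cong_right) auto
    finally show ?thesis using \<tau>(1) by simp
  qed
  have "prob {\<omega> \<in> space M. \<exists>k\<le>N. \<epsilon> \<le> \<bar>\<Sum>j<k. D j \<omega>\<bar>} \<le> prob {\<omega> \<in> space M. \<epsilon> \<le> \<bar>T N \<omega>\<bar>}"
    using stopped by (intro finite_measure_mono) auto
  also have "\<dots> \<le> expectation (\<lambda>\<omega>. (T N \<omega>)\<^sup>2) / \<epsilon>\<^sup>2"
    using T assms by (intro second_moment_method) auto
  also have "\<dots> \<le> (\<Sum>j<N. expectation (\<lambda>\<omega>. (D j \<omega>)\<^sup>2)) / \<epsilon>\<^sup>2"
    using T by (intro divide_right_mono) auto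
  finally show ?thesis .
qed

text \<open>The events for finite \<open>N\<close> increase to this one and have the common bound
  given by the full series.\<close>

lemma maximal_infinite:
  assumes "0 < \<epsilon>" and summ: "summable (\<lambda>n. expectation (\<lambda>\<omega>. (D n \<omega>)\<^sup>2))"
  shows "prob {\<omega> \<in> space M. \<exists>k. \<epsilon> \<le> \<bar>\<Sum>j<k. D j \<omega>\<bar>} \<le> (\<Sum>j. expectation (\<lambda>\<omega>. (D j \<omega>)\<^sup>2)) / \<epsilon>\<^sup>2"
proof -
  define A where "A N = {\<omega> \<in> space M. \<exists>k\<le>N. \<epsilon> \<le> \<bar>\<Sum>j<k. D j \<omega>\<bar>}" for N
  have "(\<lambda>N. prob (A N)) \<longlonglongrightarrow> prob (\<Union>N. A N)"
  proof (rule finite_Lim_measure_incseq)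
    show "range A \<subseteq> sets M" unfolding A_def by auto
    show "incseq A" unfolding A_def incseq_def by (auto intro: order_trans)
  qed
  moreover have "(\<Union>N. A N) = {\<omega> \<in> space M. \<exists>k. \<epsilon> \<le> \<bar>\<Sum>j<k. D j \<omega>\<bar>}"
    unfolding A_def by auto
  moreover have "prob (A N) \<le> (\<Sum>j. expectation (\<lambda>\<omega>. (D j \<omega>)\<^sup>2)) / \<epsilon>\<^sup>2" for N
  proof -
    have "prob (A N) \<le> (\<Sum>j<N. expectation (\<lambda>\<omega>. (D j \<omega>)\<^sup>2)) / \<epsilon>\<^sup>2"
      unfolding A_def using assms(1) by (rule kolmogorov_maximal)
    also have "\<dots> \<le> (\<Sum>j. expectation (\<lambda>\<omega>. (D j \<omega>)\<^sup>2)) / \<epsilon>\<^sup>2"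
      using summ by (intro divide_right_mono sum_le_suminf) auto
    finally show ?thesis .
  qed
  ultimately show ?thesis
    by (intro LIMSEQ_le_const2) auto
qed

lemma shift: "square_integrable_martingale_differences M (\<lambda>n. F (n + m)) (\<lambda>n. D (n + m))"
  using subalg filtration adapted square_integrable centred by unfold_locales auto

text \<open>The maximal inequality for the increments from \<open>m\<close> on is governed by the
  tail \<open>R m\<close> of the variance series, which tends to 0. Hence almost surely, for every
  threshold of the form \<open>1 / Suc n\<close>, all partial sums started at some \<open>m\<close>
  stay below it, and the Cauchy criterion applies.\<close>

theorem AE_summable:
  assumes summ: "summable (\<lambda>n. expectation (\<lambda>\<omega>. (D n \<omega>)\<^sup>2))"
  shows "AE \<omega> in M. summable (\<lambda>n. D n \<omega>)"
proof -
  define B where "B \<epsilon> m = {\<omega> \<in> space M. \<exists>k. \<epsilon> \<le> \<bar>\<Sum>j<k. D (j + m) \<omega>\<bar>}" for \<epsilon> m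
  define R where "R m = (\<Sum>j. expectation (\<lambda>\<omega>. (D (j + m) \<omega>)\<^sup>2))" for m
  have B_M: "B \<epsilon> m \<in> sets M" for \<epsilon> m
    unfolding B_def by measurable
  have R: "R \<longlonglongrightarrow> 0"
    unfolding R_def using suminf_exist_split2[OF summ] by simp
  have tail: "AE \<omega> in M. \<exists>m. \<omega> \<notin> B \<epsilon> m" if "0 < \<epsilon>" for \<epsilon>
  proof -
    have "prob (\<Inter>m. B \<epsilon> m) \<le> R m / \<epsilon>\<^sup>2" for m
    proof -
      have "prob (\<Inter>m. B \<epsilon> m) \<le> prob (B \<epsilon> m)"
        using B_M by (intro finite_measure_mono) auto
      also have "\<dots> \<le> R m / \<epsilon>\<^sup>2"
        unfolding B_def R_def
        using \<open>0 < \<epsilon>\<close> summ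
        by (intro square_integrable_martingale_differences.maximal_infinite[OF shift])
          (use summable_iff_shift[of "\<lambda>n. expectation (\<lambda>\<omega>. (D n \<omega>)\<^sup>2)" m] in auto)
      finally show ?thesis .
    qed
    moreover have "(\<lambda>m. R m / \<epsilon>\<^sup>2) \<longlonglongrightarrow> 0"
      using tendsto_divide[OF R tendsto_const[of "\<epsilon>\<^sup>2"]] \<open>0 < \<epsilon>\<close> by simp
    ultimately have "prob (\<Inter>m. B \<epsilon> m) \<le> 0"
      by (intro LIMSEQ_le_const) auto
    then have "prob (\<Inter>m. B \<epsilon> m) = 0"
      by (simp add: measure_le_0_iff)
    then have "AE \<omega> in M. \<omega> \<notin> (\<Inter>m. B \<epsilon> m)"
      using B_M by (subst prob_eq_0[symmetric]) auto
    then show ?thesis by simp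
  qed
  have "AE \<omega> in M. \<forall>n. \<exists>m. \<omega> \<notin> B (1 / Suc n) m"
    using tail by (subst AE_all_countable) auto
  then show ?thesis
    using AE_space
  proof eventually_elim
    case (elim \<omega>)
    show ?case
    proof (rule summable_Cauchy[THEN iffD2], intro allI impI)
      fix e :: real
      assume "0 < e"
      \<comment> \<open>Half of \<open>e\<close>, because a block sum over \<open>{a..<b}\<close> is
        the difference of two partial sums started at \<open>m\<close>.\<close>
      then obtain n where n: "1 / Suc n < e / 2"
        using reals_Archimedean[of "e / 2"] by (auto simp: inverse_eq_divide)
      obtain m where "\<omega> \<notin> B (1 / Suc n) m" using elim by blast
      then have m: "\<bar>\<Sum>j<k. D (j + m) \<omega>\<bar> < 1 / Suc n" for k
        using elim(2) by (auto simp: B_def not_le)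
      have "norm (\<Sum>j\<in>{a..<b}. D j \<omega>) < e" if "m \<le> a" for a b
      proof (cases "a \<le> b")
        case True
        have part: "(\<Sum>j<c - m. D (j + m) \<omega>) = (\<Sum>j\<in>{m..<c}. D j \<omega>)" if "m \<le> c" for c
          using that sum.shift_bounds_nat_ivl[of "\<lambda>j. D j \<omega>" 0 m "c - m"]
          by (simp add: atLeast0LessThan)
        have "(\<Sum>j\<in>{a..<b}. D j \<omega>) = (\<Sum>j<b - m. D (j + m) \<omega>) - (\<Sum>j<a - m. D (j + m) \<omega>)"
          using True \<open>m \<le> a\<close> part sum_diff_nat_ivl[of m a b "\<lambda>j. D j \<omega>"] by simp
        then show ?thesis
          using m[of "b - m"] m[of "a - m"] n unfolding real_norm_def by linarith
      qed (use \<open>0 < e\<close> in auto)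
      then show "\<exists>N. \<forall>a\<ge>N. \<forall>b. norm (\<Sum>j\<in>{a..<b}. D j \<omega>) < e"
        by blast
    qed
  qed
qed

end

subsection \<open>A perturbed recursion\<close>

text \<open>The drift is in factored form with roots \<open>r\<close> and \<open>-c\<close>. Since
  \<open>x n + c\<close> is at least 1, the pull towards \<open>r\<close> has strength at least
  \<open>1 / (n + k)\<close>, and the divergence of the harmonic series makes it win over a summable
  perturbation.\<close>

lemma perturbed_recursion_tendsto:
  fixes x \<eta> :: "nat \<Rightarrow> real" and r c :: real
  assumes step: "\<And>n. x (Suc n) = x n + (r - x n) * (x n + c) / real (n + k) + \<eta> n"
    and x_ge: "\<And>n. 1 \<le> x n + c" and x_le: "\<And>n. x n + c \<le> B"
    and "summable \<eta>" and "1 \<le> k"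
  shows "x \<longlonglongrightarrow> r"
proof -
  define S where "S n = (\<Sum>j. \<eta> (j + n))" for n
  \<comment> \<open>Adding the tail of the perturbation makes \<open>v (Suc n)\<close> a convex combination of \<open>v n\<close> and \<open>S n\<close>.\<close>
  define v where "v n = x n - r + S n" for n
  define b where "b n = (x n + c) / real (n + k)" for n
  have S_lim: "S \<longlonglongrightarrow> 0"
    unfolding S_def using suminf_exist_split2[OF \<open>summable \<eta>\<close>] by simp
  have S_Suc: "S n = \<eta> n + S (Suc n)" for n
  proof -
    have "summable (\<lambda>j. \<eta> (j + n))" using \<open>summable \<eta>\<close> by simp
    from suminf_split_head[OF this] show ?thesis by (simp add: S_def)
  qed
  have v_Suc: "v (Suc n) = (1 - b n) * v n + b n * S n" for n
  proof -
    have "v (Suc n) = x n - r + (r - x n) * b n + S n"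
      unfolding v_def b_def step using S_Suc[of n] by simp
    then show ?thesis unfolding v_def by (simp add: algebra_simps)
  qed
  have v_lim: "v \<longlonglongrightarrow> 0"
  proof (rule LIMSEQ_I)
    fix e :: real
    assume "0 < e"
    obtain N1 where N1: "\<bar>S n\<bar> \<le> e / 2" if "N1 \<le> n" for n
      using LIMSEQ_D[OF S_lim, of "e / 2"] \<open>0 < e\<close> by (auto intro: less_imp_le)
    \<comment> \<open>From index \<open>N2\<close> on, \<open>b n\<close> is at most 1, so that the
      combination defining \<open>v (Suc n)\<close> is really convex.\<close>
    obtain N2 where N2: "B \<le> real N2" using real_arch_simple by blast
    define N where "N = max N1 N2"
    \<comment> \<open>\<open>u\<close> is the excess of \<open>\<bar>v\<bar>\<close> over
      \<open>e / 2\<close>. Past \<open>N\<close> the term \<open>S n\<close> cannot create excess,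
      so \<open>u\<close> shrinks by the factor \<open>1 - 1 / (n + k)\<close>. Multiplying
      \<open>u n\<close> by \<open>n + k - 1\<close> turns this into monotonicity and gives decay of
      order \<open>1 / n\<close>.\<close>
    define u where "u n = max (\<bar>v n\<bar> - e / 2) 0" for n
    have dec: "(real (Suc n) + real k - 1) * u (Suc n) \<le> (real n + real k - 1) * u n" if "N \<le> n" for n
    proof -
      have b: "1 / real (n + k) \<le> b n" "b n \<le> 1"
        using x_ge[of n] x_le[of n] N2 that \<open>1 \<le> k\<close> by (auto simp: b_def N_def divide_simps)
      then have "0 \<le> b n" using x_ge[of n] unfolding b_def by simp
      have "\<bar>v (Suc n)\<bar> \<le> (1 - b n) * \<bar>v n\<bar> + b n * \<bar>S n\<bar>"
        unfolding v_Suc using b(2) \<open>0 \<le> b n\<close>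
        by (intro order_trans[OF abs_triangle_ineq]) (simp add: abs_mult)
      also have "\<dots> \<le> (1 - b n) * (u n + e / 2) + b n * (e / 2)"
        using b(2) \<open>0 \<le> b n\<close> N1[of n] that
        by (intro add_mono mult_left_mono) (auto simp: u_def N_def)
      finally have "\<bar>v (Suc n)\<bar> - e / 2 \<le> (1 - b n) * u n" by (simp add: field_simps)
      moreover have "0 \<le> (1 - b n) * u n" using b(2) by (simp add: u_def)
      ultimately have "u (Suc n) \<le> (1 - b n) * u n" by (simp add: u_def[of "Suc n"])
      also have "\<dots> \<le> (1 - 1 / real (n + k)) * u n"
        using b(1) by (intro mult_right_mono) (auto simp: u_def)
      finally have "real (n + k) * u (Suc n) \<le> real (n + k) * ((1 - 1 / real (n + k)) * u n)"
        by (intro mult_left_mono) auto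
      also have "\<dots> = (real n + real k - 1) * u n"
        using \<open>1 \<le> k\<close> by (simp add: field_simps)
      finally show ?thesis by (simp add: algebra_simps)
    qed
    have bound: "(real n + real k - 1) * u n \<le> (real N + real k - 1) * u N" if "N \<le> n" for n
      using that
    proof (induction n rule: dec_induct)
      case (step n)
      then show ?case using dec[of n] by linarith
    qed simp
    define C where "C = (real N + real k - 1) * u N"
    obtain N3 where N3: "2 * C / e < real N3" using reals_Archimedean2 by blast
    show "\<exists>n0. \<forall>n\<ge>n0. norm (v n - 0) < e"
    proof (intro exI allI impI)
      fix n assume n: "max (Suc N) N3 \<le> n"
      have "C < real n * (e / 2)"
        using N3 n \<open>0 < e\<close> by (simp add: field_simps) (smt (verit) mult_left_mono of_nat_le_iff)
      moreover have "real n * u n \<le> (real n + real k - 1) * u n"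
        using \<open>1 \<le> k\<close> by (intro mult_right_mono) (auto simp: u_def)
      ultimately have "real n * u n < real n * (e / 2)"
        using bound[of n] n unfolding C_def by linarith
      then have "u n < e / 2" by (rule mult_left_less_imp_less) simp
      then show "norm (v n - 0) < e" unfolding u_def diff_0_right real_norm_def by linarith
    qed
  qed
  have "(\<lambda>n. v n - S n + r) \<longlonglongrightarrow> 0 - 0 + r"
    by (intro tendsto_intros v_lim S_lim)
  then show ?thesis by (simp add: v_def)
qed

subsection \<open>The degree of a fixed vertex\<close>

locale srpat_vertex = srpat +
  fixes i :: nat
  assumes i_pos: "1 \<le> i"
begin

definition deg :: "nat \<Rightarrow> 'a \<Rightarrow> real" where
  "deg t \<omega> = real (tree_degree (X \<omega>) t i)"

definition weight :: "nat \<Rightarrow> 'a \<Rightarrow> real" where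
  "weight t \<omega> = real (tree_weight (X \<omega>) t i)"

definition ratio :: "nat \<Rightarrow> 'a \<Rightarrow> real" where
  "ratio t \<omega> = weight t \<omega> / (real t * deg t \<omega>)"

definition attach :: "nat \<Rightarrow> 'a \<Rightarrow> real" where
  "attach t = indicator {\<omega> \<in> space M. X \<omega> (Suc t) = i}"

definition attach_prob :: "nat \<Rightarrow> 'a \<Rightarrow> real" where
  "attach_prob t \<omega> = weight t \<omega> / (real t * (real t + 1))"

text \<open>Up to sign, the martingale part of the increment of \<open>ratio\<close>. The
  coefficient of the centred attachment is exactly the amount by which an attachment lowers the next
  ratio.\<close>

definition noise :: "nat \<Rightarrow> 'a \<Rightarrow> real" where
  "noise t \<omega> = real t / (real t + 1) * ratio t \<omega> / (deg t \<omega> + 1) * (attach t \<omega> - attach_prob t \<omega>)"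

lemma
  assumes "\<omega> \<in> space M" "i \<le> t"
  shows deg_Suc: "deg (Suc t) \<omega> = deg t \<omega> + attach t \<omega>"
    and weight_Suc: "weight (Suc t) \<omega> = weight t \<omega> + deg (Suc t) \<omega>"
    and deg_ge: "1 \<le> deg t \<omega>"
    and weight_ge: "deg t \<omega> \<le> weight t \<omega>"
    and weight_le: "weight t \<omega> \<le> real t * deg t \<omega>"
proof -
  note parent = attach_existing[OF assms(1)]
  note deg_rec = tree_degree_Suc_eq[of "X \<omega>", OF parent]
  have mono: "tree_degree (X \<omega>) s i \<le> tree_degree (X \<omega>) u i" if "s \<le> u" for s u
    using that by (induction u rule: dec_induct) (auto simp: deg_rec)
  show "deg (Suc t) \<omega> = deg t \<omega> + attach t \<omega>"
    using assms tree_degree_Suc[of "X \<omega>", OF parent assms(2)] by (simp add: deg_def attach_def indicator_def)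
  show "weight (Suc t) \<omega> = weight t \<omega> + deg (Suc t) \<omega>"
    by (simp add: weight_def deg_def tree_weight_def)
  show "1 \<le> deg t \<omega>"
    using mono[OF assms(2)] tree_degree_self[of "X \<omega>", OF parent i_pos] by (simp add: deg_def)
  show "deg t \<omega> \<le> weight t \<omega>"
    unfolding deg_def weight_def tree_weight_def of_nat_le_iff
    using assms(2) i_pos by (intro member_le_sum) auto
  have "tree_weight (X \<omega>) t i \<le> (\<Sum>s=1..t. tree_degree (X \<omega>) t i)"
    unfolding tree_weight_def by (intro sum_mono mono) auto
  also have "\<dots> = t * tree_degree (X \<omega>) t i" by simp
  finally show "weight t \<omega> \<le> real t * deg t \<omega>"
    by (simp add: weight_def deg_def flip: of_nat_mult)
qed

lemma attach_cases: "attach t \<omega> = 0 \<or> attach t \<omega> = 1"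
  by (simp add: attach_def indicator_def)

lemma
  assumes "\<omega> \<in> space M" "i \<le> t"
  shows ratio_pos: "0 < ratio t \<omega>" and ratio_le_1: "ratio t \<omega> \<le> 1"
    and attach_prob_eq: "attach_prob t \<omega> = ratio t \<omega> * deg t \<omega> / (real t + 1)"
    and attach_prob_nonneg: "0 \<le> attach_prob t \<omega>"
    and attach_prob_le_1: "attach_prob t \<omega> \<le> 1"
    and weight_eq: "weight t \<omega> = ratio t \<omega> * real t * deg t \<omega>"
proof -
  have t: "1 \<le> real t" using assms i_pos by simp
  note * = deg_ge[OF assms] weight_ge[OF assms] weight_le[OF assms]
  show "0 < ratio t \<omega>" "ratio t \<omega> \<le> 1"
    using * t by (auto simp: ratio_def divide_simps)
  show "attach_prob t \<omega> = ratio t \<omega> * deg t \<omega> / (real t + 1)"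
    using * t by (simp add: ratio_def attach_prob_def)
  show "weight t \<omega> = ratio t \<omega> * real t * deg t \<omega>"
    using * t by (simp add: ratio_def)
  show "0 \<le> attach_prob t \<omega>"
    using * t by (simp add: attach_prob_def)
  \<comment> \<open>The degree is at most the number of edges. With \<open>weight_le\<close> this
    bounds the weight by \<open>t * (t + 1)\<close>.\<close>
  have "tree_degree (X \<omega>) t i \<le> t"
  proof -
    have "card {e \<in> tree_edges (X \<omega>) t. i \<in> e} \<le> card (tree_edges (X \<omega>) t)"
      by (intro card_mono finite_tree_edges) auto
    also have "\<dots> \<le> t"
      unfolding tree_edges_def using card_image_le[of "{1..t}"] by simp
    finally show ?thesis by (simp add: tree_degree_def)
  qed
  then have "deg t \<omega> \<le> real t + 1" by (simp add: deg_def)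
  then have "weight t \<omega> \<le> real t * (real t + 1)"
    using *(3) t by (elim order_trans) (intro mult_left_mono, auto)
  then show "attach_prob t \<omega> \<le> 1"
    using t by (simp add: attach_prob_def divide_simps)
qed

text \<open>The new ratio is affine in \<open>attach t\<close>. Replacing \<open>attach t\<close> by
  its conditional mean \<open>x * deg t / (t + 1)\<close> yields the drift and the correction with
  factor \<open>x\<^sup>2\<close>; the remainder is \<open>- noise t\<close>.\<close>

lemma ratio_Suc:
  assumes "\<omega> \<in> space M" "i \<le> t"
  defines "x \<equiv> ratio t \<omega>"
  shows "ratio (Suc t) \<omega> = x + (1 - x - x\<^sup>2) / (real t + 1) +
    (x\<^sup>2 / (real t + 1) * (1 - real t / (real t + 1) * (deg t \<omega> / (deg t \<omega> + 1))) - noise t \<omega>)"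
proof -
  define T E where "T = 1 / (real t + 1)" and "E = 1 / (deg t \<omega> + 1)"
  have d: "1 \<le> deg t \<omega>" using deg_ge[OF assms(1,2)] .
  have t: "real t / (real t + 1) = 1 - T" by (simp add: T_def field_simps)
  have dE: "deg t \<omega> / (deg t \<omega> + 1) = 1 - E" using d by (simp add: E_def field_simps)
  have dE': "deg t \<omega> * E = 1 - E" using dE by (simp add: E_def)
  \<comment> \<open>This linearisation is exact because \<open>attach\<close> takes only the values
    0 and 1.\<close>
  have q: "deg t \<omega> / (deg t \<omega> + attach t \<omega>) = 1 - attach t \<omega> * E"
    using attach_cases[of t \<omega>] d by (auto simp: E_def field_simps)
  have pos: "0 < deg t \<omega> + attach t \<omega>" using attach_cases[of t \<omega>] d by auto
  have "ratio (Suc t) \<omega> = (x * real t * deg t \<omega> + (deg t \<omega> + attach t \<omega>)) / ((real t + 1) * (deg t \<omega> + attach t \<omega>))"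
    unfolding ratio_def[of "Suc t"] weight_Suc[OF assms(1,2)] deg_Suc[OF assms(1,2)]
      weight_eq[OF assms(1,2)] x_def by (simp add: add.commute)
  also have "\<dots> = x * (real t / (real t + 1)) * (deg t \<omega> / (deg t \<omega> + attach t \<omega>)) + T"
    unfolding add_divide_distrib[of "x * real t * deg t \<omega>"] using pos by (simp add: T_def)
  also have "\<dots> = x * (1 - T) * (1 - attach t \<omega> * E) + T"
    unfolding q t ..
  finally have *: "ratio (Suc t) \<omega> = x * (1 - T) * (1 - attach t \<omega> * E) + T" .
  have "noise t \<omega> = (1 - T) * x * E * (attach t \<omega> - x * deg t \<omega> * T)"
    unfolding noise_def t attach_prob_eq[OF assms(1,2)] by (simp add: x_def T_def E_def)
  also have "\<dots> = (1 - T) * x * (attach t \<omega> * E - x * (deg t \<omega> * E) * T)"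
    by (simp add: algebra_simps)
  finally have **: "noise t \<omega> = (1 - T) * x * (attach t \<omega> * E - x * (1 - E) * T)"
    unfolding dE' .
  have div: "a / (real t + 1) = a * T" for a by (simp add: T_def)
  show ?thesis
    unfolding * ** t dE unfolding div by (simp add: algebra_simps power2_eq_square)
qed

subsection \<open>Measurability and conditional expectations\<close>

lemma deg_history_measurable:
  assumes "s \<le> t" "i \<le> t"
  shows "deg s \<in> borel_measurable (tree_history M X t)"
\<comment> \<open>The history is generated by degrees from time 1 on. At time 0 there is no edge, so
  \<open>deg 0\<close> is constant.\<close>
proof (cases "s = 0")
  case True
  then show ?thesis by (simp add: deg_def[abs_def] tree_degree_def tree_edges_def)
next
  case False
  have "(\<lambda>\<omega>. tree_degree (X \<omega>) s i) \<in> measurable (tree_history M X t) (count_space UNIV)"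
  proof (rule measurableI)
    fix A :: "nat set"
    have "(\<lambda>\<omega>. tree_degree (X \<omega>) s i) -` A \<inter> space M \<in> sets (tree_history M X t)"
      unfolding tree_history_def using assms False
      by (intro in_measure_of) (auto, metis Suc_leI)
    then show "(\<lambda>\<omega>. tree_degree (X \<omega>) s i) -` A \<inter> space (tree_history M X t) \<in> sets (tree_history M X t)"
      using subalgebra_tree_history[of t] by (simp add: subalgebra_def)
  qed auto
  then show ?thesis
    unfolding deg_def[abs_def] by (rule measurable_compose) simp
qed

lemma
  assumes "i \<le> t"
  shows weight_history_measurable: "weight t \<in> borel_measurable (tree_history M X t)"
    and ratio_history_measurable: "ratio t \<in> borel_measurable (tree_history M X t)"
    and attach_prob_history_measurable: "attach_prob t \<in> borel_measurable (tree_history M X t)"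
proof -
  note [measurable] = deg_history_measurable[OF order_refl assms]
  have "weight t = (\<lambda>\<omega>. \<Sum>s=1..t. deg s \<omega>)"
    by (simp add: weight_def deg_def tree_weight_def fun_eq_iff)
  then show [measurable]: "weight t \<in> borel_measurable (tree_history M X t)"
    using deg_history_measurable assms by (auto intro!: borel_measurable_sum)
  show "ratio t \<in> borel_measurable (tree_history M X t)"
    unfolding ratio_def[abs_def] by measurable
  show "attach_prob t \<in> borel_measurable (tree_history M X t)"
    unfolding attach_prob_def[abs_def] by measurable
qed

lemma attach_measurable' [measurable]: "attach t \<in> borel_measurable M"
proof -
  note [measurable] = attach_measurable[of "Suc t"]
  have "{\<omega> \<in> space M. X \<omega> (Suc t) = i} \<in> sets M" by measurable
  then show ?thesis unfolding attach_def by (rule borel_measurable_indicator)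
qed

text \<open>The history records degrees rather than attachments, so the attachment is recovered as a
  degree increment.\<close>

lemma attach_history_measurable:
  assumes "i \<le> t"
  shows "attach t \<in> borel_measurable (tree_history M X (Suc t))"
proof -
  have "(\<lambda>\<omega>. deg (Suc t) \<omega> - deg t \<omega>) \<in> borel_measurable (tree_history M X (Suc t))"
    using assms by (intro borel_measurable_diff deg_history_measurable) auto
  moreover have "attach t \<omega> = deg (Suc t) \<omega> - deg t \<omega>" if "\<omega> \<in> space (tree_history M X (Suc t))" for \<omega>
    using that deg_Suc[of \<omega> t] assms subalgebra_tree_history[of "Suc t"] by (simp add: subalgebra_def)
  ultimately show ?thesis by (simp cong: measurable_cong)
qed

lemma history_mono: "sets (tree_history M X t) \<subseteq> sets (tree_history M X (Suc t))"
  unfolding tree_history_def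
  by (subst (1 2) sets_measure_of) (auto intro!: sigma_sets_mono', fastforce)

lemma M_measurable:
  assumes "i \<le> t"
  shows "deg t \<in> borel_measurable M" "ratio t \<in> borel_measurable M" "attach_prob t \<in> borel_measurable M"
  using measurable_from_subalg[OF subalgebra_tree_history]
    deg_history_measurable[OF order_refl assms] ratio_history_measurable[OF assms]
    attach_prob_history_measurable[OF assms] by blast+

text \<open>The common source of all later martingale identities: \<open>noise\<close>, its squared
  bound and the decrease of \<open>1 / deg\<close> each involve a centred attachment with a bounded
  coefficient known at time \<open>t\<close>.\<close>

lemma
  assumes "i \<le> t" and c: "c \<in> borel_measurable (tree_history M X t)"
    and bound: "\<And>\<omega>. \<omega> \<in> space M \<Longrightarrow> \<bar>c \<omega>\<bar> \<le> 1"
  shows cond_exp_attach: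
      "AE \<omega> in M. real_cond_exp M (tree_history M X t) (\<lambda>\<omega>. c \<omega> * (attach t \<omega> - attach_prob t \<omega>)) \<omega> = 0"
    and integrable_attach: "integrable M (\<lambda>\<omega>. c \<omega> * (attach t \<omega> - attach_prob t \<omega>))"
    and expectation_attach: "expectation (\<lambda>\<omega>. c \<omega> * (attach t \<omega> - attach_prob t \<omega>)) = 0"
proof -
  let ?F = "tree_history M X t"
  interpret sub: finite_measure_subalgebra M ?F
    by unfold_locales (rule subalgebra_tree_history)
  note [measurable] = M_measurable[OF assms(1)] measurable_from_subalg[OF subalgebra_tree_history c]
  have ap: "0 \<le> attach_prob t \<omega>" "attach_prob t \<omega> \<le> 1" if "\<omega> \<in> space M" for \<omega>
    using that attach_prob_nonneg attach_prob_le_1 assms(1) by auto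
  have int_p: "integrable M (attach_prob t)"
    using ap by (intro integrable_const_bound[where B = 1]) auto
  have int_a: "integrable M (attach t)"
  proof (intro integrable_const_bound[where B = 1] AE_I2)
    show "norm (attach t \<omega>) \<le> 1" for \<omega>
      using attach_cases[of t \<omega>] by auto
  qed simp
  show int: "integrable M (\<lambda>\<omega>. c \<omega> * (attach t \<omega> - attach_prob t \<omega>))"
  proof (intro integrable_const_bound[where B = 1] AE_I2)
    fix \<omega> assume "\<omega> \<in> space M"
    then have "\<bar>c \<omega>\<bar> * \<bar>attach t \<omega> - attach_prob t \<omega>\<bar> \<le> 1 * 1"
      using ap[of \<omega>] bound attach_cases[of t \<omega>] by (intro mult_mono) auto
    then show "norm (c \<omega> * (attach t \<omega> - attach_prob t \<omega>)) \<le> 1" by (simp add: abs_mult)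
  qed simp
  \<comment> \<open>The total weight \<open>t * (t + 1)\<close> turns the attachment rule of the
    model into \<open>attach_prob\<close>.\<close>
  have "AE \<omega> in M. real_cond_exp M ?F (attach t) \<omega> = attach_prob t \<omega>"
    using attach_cond_prob[OF order_trans[OF i_pos assms(1)] assms(1)] AE_space
  proof eventually_elim
    case (elim \<omega>)
    have "(\<Sum>j=0..t. real (tree_weight (X \<omega>) t j)) = real t * (real t + 1)"
      using sum_tree_weight[of "X \<omega>" t] attach_existing[OF elim(2)]
      by (simp add: algebra_simps flip: of_nat_sum)
    with elim(1) show ?case
      by (simp add: attach_def attach_prob_def weight_def)
  qed
  moreover note sub.real_cond_exp_diff[OF int_a int_p]
    sub.real_cond_exp_F_meas[OF int_p attach_prob_history_measurable[OF assms(1)]]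
    sub.real_cond_exp_mult[OF c borel_measurable_diff[OF attach_measurable' M_measurable(3)[OF assms(1)]] int]
  ultimately show zero: "AE \<omega> in M. real_cond_exp M ?F (\<lambda>\<omega>. c \<omega> * (attach t \<omega> - attach_prob t \<omega>)) \<omega> = 0"
    by eventually_elim simp
  have "expectation (\<lambda>\<omega>. c \<omega> * (attach t \<omega> - attach_prob t \<omega>)) =
      expectation (real_cond_exp M ?F (\<lambda>\<omega>. c \<omega> * (attach t \<omega> - attach_prob t \<omega>)))"
    using int by (simp add: sub.real_cond_exp_int)
  also have "\<dots> = expectation (\<lambda>\<omega>. 0)"
    using zero by (intro integral_cong_AE) auto
  finally show "expectation (\<lambda>\<omega>. c \<omega> * (attach t \<omega> - attach_prob t \<omega>)) = 0" by simp
qed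

section \<open>Telescoping control of the conditional variances\<close>

definition rate :: "nat \<Rightarrow> 'a \<Rightarrow> real" where
  "rate t \<omega> = attach_prob t \<omega> / (deg t \<omega> * (deg t \<omega> + 1))"

lemma
  assumes "i \<le> t"
  shows integrable_rate: "integrable M (rate t)"
    and expectation_rate: "expectation (rate t) = expectation (\<lambda>\<omega>. 1 / deg t \<omega>) - expectation (\<lambda>\<omega>. 1 / deg (Suc t) \<omega>)"
proof -
  note [measurable] = M_measurable[OF assms] deg_history_measurable[OF order_refl assms] M_measurable(1)[of "Suc t"]
  define c where "c \<omega> = 1 / (deg t \<omega> * (deg t \<omega> + 1))" for \<omega>
  have c_bound: "0 \<le> c \<omega>" "c \<omega> \<le> 1" if "\<omega> \<in> space M" for \<omega>
    using deg_ge[OF that assms] mult_mono[of 1 "deg t \<omega>" 1 "deg t \<omega> + 1"]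
    by (auto simp: c_def divide_simps)
  have [measurable]: "c \<in> borel_measurable (tree_history M X t)" "c \<in> borel_measurable M"
    unfolding c_def by measurable
  have rate: "rate t \<omega> = c \<omega> * attach_prob t \<omega>" for \<omega> by (simp add: rate_def c_def)
  have "norm (rate t \<omega>) \<le> 1" if "\<omega> \<in> space M" for \<omega>
    using that c_bound[of \<omega>] attach_prob_nonneg[of \<omega> t] attach_prob_le_1[of \<omega> t] assms
    by (auto simp: rate abs_mult intro: mult_le_one)
  moreover have "rate t \<in> borel_measurable M"
    unfolding rate_def[abs_def] by measurable
  ultimately show int: "integrable M (rate t)"
    by (intro integrable_const_bound[where B = 1]) auto
  have int_d: "integrable M (\<lambda>\<omega>. 1 / deg s \<omega>)" if "i \<le> s" for s
    using that M_measurable(1)[of s] deg_ge[of _ s]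
    by (intro integrable_const_bound[where B = 1]) (force simp: divide_simps)+
  \<comment> \<open>An attachment lowers \<open>1 / deg\<close> by exactly \<open>c\<close>;
    splitting \<open>attach\<close> into its centred part and \<open>attach_prob\<close> leaves
    \<open>rate\<close> as the conditional mean.\<close>
  have "1 / deg t \<omega> - 1 / deg (Suc t) \<omega> = c \<omega> * (attach t \<omega> - attach_prob t \<omega>) + rate t \<omega>" if "\<omega> \<in> space M" for \<omega>
  proof -
    have "1 / deg t \<omega> - 1 / deg (Suc t) \<omega> = c \<omega> * attach t \<omega>"
      using deg_ge[OF that assms] attach_cases[of t \<omega>]
      unfolding c_def deg_Suc[OF that assms] by (auto simp: diff_frac_eq)
    then show ?thesis by (simp add: rate algebra_simps)
  qed
  then have "expectation (\<lambda>\<omega>. 1 / deg t \<omega> - 1 / deg (Suc t) \<omega>) =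
      expectation (\<lambda>\<omega>. c \<omega> * (attach t \<omega> - attach_prob t \<omega>) + rate t \<omega>)"
    by (intro Bochner_Integration.integral_cong) auto
  also have "\<dots> = expectation (rate t)"
    using integrable_attach[of t c] expectation_attach[of t c] int c_bound assms by simp
  finally show "expectation (rate t) = expectation (\<lambda>\<omega>. 1 / deg t \<omega>) - expectation (\<lambda>\<omega>. 1 / deg (Suc t) \<omega>)"
    using int_d assms by simp
qed

lemma rate_nonneg: "\<omega> \<in> space M \<Longrightarrow> i \<le> t \<Longrightarrow> 0 \<le> rate t \<omega>"
  using deg_ge[of \<omega> t] attach_prob_nonneg[of \<omega> t] by (simp add: rate_def)

lemma summable_expectation_rate: "summable (\<lambda>n. expectation (rate (n + i)))"
proof (rule summableI_nonneg_bounded)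
  fix n
  show "0 \<le> expectation (rate (n + i))"
    by (intro integral_nonneg_AE AE_I2 rate_nonneg) auto
  have int_d: "integrable M (\<lambda>\<omega>. 1 / deg i \<omega>)"
    using M_measurable(1)[of i] deg_ge[of _ i]
    by (intro integrable_const_bound[where B = 1]) (force simp: divide_simps)+
  have "(\<Sum>k<n. expectation (rate (k + i))) =
      (\<Sum>k<n. expectation (\<lambda>\<omega>. 1 / deg (k + i) \<omega>) - expectation (\<lambda>\<omega>. 1 / deg (Suc k + i) \<omega>))"
    by (simp add: expectation_rate)
  also have "\<dots> = expectation (\<lambda>\<omega>. 1 / deg i \<omega>) - expectation (\<lambda>\<omega>. 1 / deg (n + i) \<omega>)"
    by (subst sum_lessThan_telescope') simp
  also have "\<dots> \<le> expectation (\<lambda>\<omega>. 1 / deg i \<omega>)"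
    by (simp add: deg_def)
  also have "\<dots> \<le> expectation (\<lambda>\<omega>. 1)"
    using int_d deg_ge[of _ i] by (intro integral_mono) (force simp: divide_simps)+
  finally show "(\<Sum>k<n. expectation (rate (k + i))) \<le> 1" by (simp add: prob_space)
qed

text \<open>The coefficient of the centred attachment is at most \<open>1 / (deg + 1)\<close>, and
  the conditional variance of the attachment is at most \<open>attach_prob\<close>. Since
  \<open>(deg + 1)\<^sup>2\<close> is at least \<open>deg * (deg + 1)\<close>, \<open>rate\<close>
  dominates.\<close>

lemma
  assumes "i \<le> t"
  shows noise_cond_exp: "AE \<omega> in M. real_cond_exp M (tree_history M X t) (noise t) \<omega> = 0"
    and noise_history_measurable: "noise t \<in> borel_measurable (tree_history M X (Suc t))"
    and noise_square_integrable: "integrable M (\<lambda>\<omega>. (noise t \<omega>)\<^sup>2)"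
    and noise_square_le: "expectation (\<lambda>\<omega>. (noise t \<omega>)\<^sup>2) \<le> expectation (rate t)"
proof -
  let ?F = "tree_history M X t"
  note F_meas [measurable] = deg_history_measurable[OF order_refl assms] ratio_history_measurable[OF assms]
    attach_prob_history_measurable[OF assms]
  note [measurable] = M_measurable[OF assms]
  define e where "e \<omega> = 1 / (deg t \<omega> + 1)" for \<omega>
  define c where "c \<omega> = real t / (real t + 1) * ratio t \<omega> / (deg t \<omega> + 1)" for \<omega>
  have [measurable]: "e \<in> borel_measurable ?F" "e \<in> borel_measurable M"
    "c \<in> borel_measurable ?F" "c \<in> borel_measurable M"
    unfolding e_def c_def by measurable
  have noise: "noise t = (\<lambda>\<omega>. c \<omega> * (attach t \<omega> - attach_prob t \<omega>))"
    by (simp add: noise_def c_def fun_eq_iff)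
  have e: "0 \<le> e \<omega>" "e \<omega> \<le> 1" if "\<omega> \<in> space M" for \<omega>
    using deg_ge[OF that assms] by (auto simp: e_def)
  have c: "0 \<le> c \<omega>" "c \<omega> \<le> e \<omega>" if "\<omega> \<in> space M" for \<omega>
  proof -
    have "real t / (real t + 1) * ratio t \<omega> \<le> 1 * 1"
      using ratio_le_1[OF that assms] ratio_pos[OF that assms] by (intro mult_mono) auto
    then show "c \<omega> \<le> e \<omega>"
      unfolding c_def e_def using deg_ge[OF that assms] by (intro divide_right_mono) auto
    show "0 \<le> c \<omega>"
      using ratio_pos[OF that assms] deg_ge[OF that assms] by (simp add: c_def)
  qed
  have c1: "\<bar>c \<omega>\<bar> \<le> 1" if "\<omega> \<in> space M" for \<omega>
    using c[OF that] e[OF that] by simp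
  show "AE \<omega> in M. real_cond_exp M ?F (noise t) \<omega> = 0"
    unfolding noise using assms c1 by (intro cond_exp_attach) auto
  have "subalgebra (tree_history M X (Suc t)) ?F"
    using history_mono[of t] subalgebra_tree_history[of t] subalgebra_tree_history[of "Suc t"]
    by (simp add: subalgebra_def)
  note lift = measurable_from_subalg[OF this]
  have [measurable]: "c \<in> borel_measurable (tree_history M X (Suc t))"
      "attach_prob t \<in> borel_measurable (tree_history M X (Suc t))"
      "attach t \<in> borel_measurable (tree_history M X (Suc t))"
    using assms attach_history_measurable by (auto intro!: lift)
  show "noise t \<in> borel_measurable (tree_history M X (Suc t))"
    unfolding noise by measurable
  have p: "0 \<le> attach_prob t \<omega>" "attach_prob t \<omega> \<le> 1" if "\<omega> \<in> space M" for \<omega>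
    using attach_prob_nonneg[OF that assms] attach_prob_le_1[OF that assms] by auto
  show int: "integrable M (\<lambda>\<omega>. (noise t \<omega>)\<^sup>2)"
  proof (intro integrable_const_bound[where B = 1] AE_I2)
    fix \<omega> assume w: "\<omega> \<in> space M"
    have "\<bar>c \<omega>\<bar> * \<bar>attach t \<omega> - attach_prob t \<omega>\<bar> \<le> 1 * 1"
      using w p[OF w] c1 attach_cases[of t \<omega>] by (intro mult_mono) auto
    then have "\<bar>noise t \<omega>\<bar> \<le> 1" by (simp add: noise abs_mult)
    then show "norm ((noise t \<omega>)\<^sup>2) \<le> 1" by (simp add: abs_square_le_1)
  qed (simp add: noise)
  \<comment> \<open>For \<open>a\<close> in {0, 1},
    \<open>(a - p)\<^sup>2 = (1 - 2 * p) * (a - p) + (p - p\<^sup>2)\<close>. So the square is again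
    a centred attachment with known coefficient plus a known term.\<close>
  define b where "b \<omega> = (e \<omega>)\<^sup>2 * (1 - 2 * attach_prob t \<omega>)" for \<omega>
  have b: "\<bar>b \<omega>\<bar> \<le> 1" if "\<omega> \<in> space M" for \<omega>
  proof -
    have "\<bar>(e \<omega>)\<^sup>2\<bar> * \<bar>1 - 2 * attach_prob t \<omega>\<bar> \<le> 1 * 1"
      using p[OF that] e[OF that] by (intro mult_mono) (auto simp: power_le_one)
    then show ?thesis by (simp add: b_def abs_mult)
  qed
  have [measurable]: "b \<in> borel_measurable ?F" unfolding b_def by measurable
  have "(noise t \<omega>)\<^sup>2 \<le> b \<omega> * (attach t \<omega> - attach_prob t \<omega>) + rate t \<omega>" if w: "\<omega> \<in> space M" for \<omega>
  proof -
    have "(noise t \<omega>)\<^sup>2 \<le> (e \<omega>)\<^sup>2 * (attach t \<omega> - attach_prob t \<omega>)\<^sup>2"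
      unfolding noise power_mult_distrib using c[OF w] by (intro mult_right_mono power_mono) auto
    also have "\<dots> = b \<omega> * (attach t \<omega> - attach_prob t \<omega>) + (e \<omega>)\<^sup>2 * (attach_prob t \<omega> - (attach_prob t \<omega>)\<^sup>2)"
      using attach_cases[of t \<omega>] by (auto simp: b_def power2_eq_square algebra_simps)
    also have "(e \<omega>)\<^sup>2 * (attach_prob t \<omega> - (attach_prob t \<omega>)\<^sup>2) \<le> (e \<omega>)\<^sup>2 * attach_prob t \<omega>"
      by (intro mult_left_mono) auto
    also have "\<dots> \<le> rate t \<omega>"
      unfolding rate_def e_def using p[OF w] deg_ge[OF w assms]
      by (simp add: power2_eq_square) (intro divide_left_mono mult_right_mono mult_pos_pos, auto)
    finally show ?thesis by simp
  qed
  then have "expectation (\<lambda>\<omega>. (noise t \<omega>)\<^sup>2) \<le> expectation (\<lambda>\<omega>. b \<omega> * (attach t \<omega> - attach_prob t \<omega>) + rate t \<omega>)"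
    using int integrable_attach[of t b] integrable_rate[OF assms] assms b by (intro integral_mono) auto
  also have "\<dots> = expectation (rate t)"
    using integrable_attach[of t b] expectation_attach[of t b] integrable_rate[OF assms] assms b by simp
  finally show "expectation (\<lambda>\<omega>. (noise t \<omega>)\<^sup>2) \<le> expectation (rate t)" .
qed

section \<open>Almost sure convergence\<close>

lemma AE_summable_noise: "AE \<omega> in M. summable (\<lambda>n. noise (n + i) \<omega>)"
proof -
  interpret square_integrable_martingale_differences M "\<lambda>n. tree_history M X (n + i)" "\<lambda>n. noise (n + i)"
    using subalgebra_tree_history history_mono noise_cond_exp noise_history_measurable noise_square_integrable
    by unfold_locales auto
  have "summable (\<lambda>n. expectation (\<lambda>\<omega>. (noise (n + i) \<omega>)\<^sup>2))"
    by (rule summable_comparison_test'[OF summable_expectation_rate, of 0]) (simp add: noise_square_le)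
  then show ?thesis by (rule AE_summable)
qed

lemma AE_summable_rate: "AE \<omega> in M. summable (\<lambda>n. rate (n + i) \<omega>)"
  using summable_expectation_rate
  by (rule AE_summable_of_summable_integral[rotated 2]) (auto intro: integrable_rate rate_nonneg)

lemma ratio_tendsto:
  assumes w: "\<omega> \<in> space M"
    and noise: "summable (\<lambda>n. noise (n + i) \<omega>)" and rate: "summable (\<lambda>n. rate (n + i) \<omega>)"
  shows "(\<lambda>n. ratio (n + i) \<omega>) \<longlonglongrightarrow> (sqrt 5 - 1) / 2"
proof -
  define err where "err t = (ratio t \<omega>)\<^sup>2 / (real t + 1) *
      (1 - real t / (real t + 1) * (deg t \<omega> / (deg t \<omega> + 1)))" for t
  \<comment> \<open>With \<open>T = 1 / (t + 1)\<close> and \<open>E = 1 / (deg + 1)\<close>, the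
    bracket in \<open>err\<close> is at most \<open>T + E\<close>. The \<open>T\<close> part gives
    the inverse square, and \<open>x * T * E\<close> is exactly \<open>rate\<close>.\<close>
  have err: "0 \<le> err t" "err t \<le> 1 / (real (Suc t))\<^sup>2 + rate t \<omega>" if t: "i \<le> t" for t
  proof -
    define x where "x = ratio t \<omega>"
    define T E where "T = 1 / (real t + 1)" and "E = 1 / (deg t \<omega> + 1)"
    have d: "1 \<le> deg t \<omega>" using deg_ge[OF w t] .
    have x: "0 < x" "x \<le> 1" using ratio_pos[OF w t] ratio_le_1[OF w t] by (auto simp: x_def)
    have T: "0 \<le> T" "T \<le> 1" and E: "0 \<le> E" "E \<le> 1" using d by (auto simp: T_def E_def)
    have tT: "real t / (real t + 1) = 1 - T" by (simp add: T_def field_simps)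
    have dE: "deg t \<omega> / (deg t \<omega> + 1) = 1 - E" using d by (simp add: E_def field_simps)
    have e: "err t = x\<^sup>2 * T * (1 - (1 - T) * (1 - E))"
      unfolding err_def tT dE by (simp add: x_def T_def)
    have "(1 - T) * (1 - E) \<le> 1" using T E by (intro mult_le_one) auto
    then show "0 \<le> err t" unfolding e using T by simp
    have "err t \<le> x\<^sup>2 * T * (T + E)"
      unfolding e using T E by (intro mult_left_mono) (auto simp: algebra_simps)
    also have "\<dots> = x\<^sup>2 * T\<^sup>2 + x\<^sup>2 * T * E" by (simp add: power2_eq_square algebra_simps)
    also have "\<dots> \<le> 1 * T\<^sup>2 + x * T * E"
      using x T E by (intro add_mono mult_right_mono) (auto simp: power2_eq_square mult_left_le mult_le_one)
    also have "x * T * E = rate t \<omega>"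
      using d unfolding rate_def attach_prob_eq[OF w t] by (simp add: x_def T_def E_def)
    finally show "err t \<le> 1 / (real (Suc t))\<^sup>2 + rate t \<omega>"
      by (simp add: T_def power_divide add.commute)
  qed
  have "summable (\<lambda>n. 1 / (real (Suc n))\<^sup>2)"
    using inverse_power_summable[of 2, where 'a = real] summable_Suc_iff[of "\<lambda>n. 1 / (real n)\<^sup>2"]
    by (simp add: inverse_eq_divide)
  then have "summable (\<lambda>n. 1 / (real (Suc (n + i)))\<^sup>2)"
    by (rule summable_ignore_initial_segment)
  then have "summable (\<lambda>n. 1 / (real (Suc (n + i)))\<^sup>2 + rate (n + i) \<omega>)"
    using rate by (rule summable_add)
  then have "summable (\<lambda>n. err (n + i))"
    by (rule summable_comparison_test'[of _ 0]) (simp add: err del: of_nat_Suc)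
  then have summ: "summable (\<lambda>n. err (n + i) - noise (n + i) \<omega>)"
    using noise by (rule summable_diff)
  show ?thesis
  \<comment> \<open>Here \<open>c\<close> is the golden ratio, as \<open>1 - x - x\<^sup>2\<close>
    has the roots \<open>(sqrt 5 - 1) / 2\<close> and \<open>- (1 + sqrt 5) / 2\<close>. The offset
    is \<open>Suc i\<close>, because the step from time \<open>n + i\<close> divides by
    \<open>n + i + 1\<close>.\<close>
  proof (rule perturbed_recursion_tendsto[OF _ _ _ summ])
    fix n
    have x: "0 < ratio (n + i) \<omega>" "ratio (n + i) \<omega> \<le> 1"
      using ratio_pos[OF w] ratio_le_1[OF w] by auto
    show "1 \<le> ratio (n + i) \<omega> + (1 + sqrt 5) / 2"
      using x(1) by (intro add_increasing) auto
    show "ratio (n + i) \<omega> + (1 + sqrt 5) / 2 \<le> 1 + (1 + sqrt 5) / 2"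
      using x by simp
    have "((sqrt 5 - 1) / 2 - x) * (x + (1 + sqrt 5) / 2) = 1 - x - x\<^sup>2" for x :: real
      by (simp add: field_simps power2_eq_square)
    then show "ratio (Suc n + i) \<omega> = ratio (n + i) \<omega> +
        ((sqrt 5 - 1) / 2 - ratio (n + i) \<omega>) * (ratio (n + i) \<omega> + (1 + sqrt 5) / 2) / real (n + Suc i) +
        (err (n + i) - noise (n + i) \<omega>)"
      using ratio_Suc[OF w, of "n + i"] by (simp add: err_def add_ac)
  qed simp
qed

text \<open>Valid for every \<open>t\<close>, also before the vertex arrives: division by 0 gives 0
  on both sides.\<close>

lemma tree_alpha_eq: "tree_alpha (X \<omega>) t i = inverse (ratio t \<omega>)"
  by (simp add: tree_alpha_def ratio_def deg_def weight_def)

theorem AE_tree_alpha_tendsto: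
  "AE \<omega> in M. (\<lambda>t. tree_alpha (X \<omega>) t i) \<longlonglongrightarrow> (1 + sqrt 5) / 2"
  using AE_summable_noise AE_summable_rate AE_space
proof eventually_elim
  case (elim \<omega>)
  have "sqrt 5 \<noteq> (1::real)" by simp
  then have "(\<lambda>n. inverse (ratio (n + i) \<omega>)) \<longlonglongrightarrow> inverse ((sqrt 5 - 1) / 2)"
    using elim by (intro tendsto_inverse ratio_tendsto) auto
  moreover have "inverse ((sqrt 5 - 1) / 2) = (1 + sqrt 5) / (2::real)"
    using \<open>sqrt 5 \<noteq> 1\<close> by (simp add: field_simps)
  ultimately show ?case
    unfolding tree_alpha_eq using LIMSEQ_offset[of "\<lambda>t. inverse (ratio t \<omega>)" i] by (simp only:)
qed

end

theorem theorem1: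
  fixes M :: "'a measure" and X :: "'a \<Rightarrow> nat \<Rightarrow> nat" and i :: nat
  assumes "srpat M X" and "1 \<le> i"
  shows "AE \<omega> in M. (\<lambda>t. tree_alpha (X \<omega>) t i) \<longlonglongrightarrow> (1 + sqrt 5) / 2"
proof -
  interpret srpat_vertex M X i
    using assms by (simp add: srpat_vertex_def srpat_vertex_axioms_def)
  show ?thesis by (rule AE_tree_alpha_tendsto)
qed

end
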